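(* Let $G$ be a graph of order $n$ with minimum degree $\delta(G)=1$ and with no full vertex. Then $\mathcal{C}(G)=n$ if and only if $G\in\mathcal{F}_1$.
   Context: All graphs are finite and simple. For a graph $G$ with vertex set $V$, a set $S\subseteq V$ is a dominating set if every vertex of $V\setminus S$ is adjacent to a vertex of $S$. Two disjoint sets $V_1,V_2\subseteq V$ form a coalition in $G$ if neither is a dominating set of $G$ but $V_1\cup V_2$ is. A coalition partition of $G$ is a partition $\Psi=\{V_1,\ldots,V_k\}$ of $V$ such that every $V_i\in\Psi$ is either a dominating set of $G$ with $|V_i|=1$, or is not a dominating set and forms a coalition with some $V_j\in\Psi$. The coalition number $\mathcal{C}(G)$ is the maximum cardinality of a coalition partition of $G$. The order is $n=|V|$; a full vertex is a vertex of degree $n-1$. The family $\mathcal{F}_1$ consists of all isolate-free graphs $G$ constructed as follows. The vertex set is $V(G)=\{x,y,w\}\cup P\cup Q$, where $\{x,y,w\}$, $P$, $Q$ are pairwise disjoint, $|P\cup Q|\ge 1$, and if $Q\neq\emptyset$ then $|Q|\ge 2$. The edges are: $N_G(x)=\{y\}$ and $N_G(w)=P\cup Q$; each vertex $p\in P$ is joined to every vertex of $(P\cup Q)\setminus\{p\}$; if $Q\neq\emptyset$, then $y$ is joined to every vertex of $Q$, and some edges (possibly none) are added among vertices of $Q$ in such a way that $G[Q]$ has no full vertex (i.e., every $q\in Q$ is nonadjacent to at least one vertex of $Q\setminus\{q\}$); finally, any number of edges (possibly none) are added between $y$ and vertices of $P$. No other edges are present. *)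

theory Defs
  imports "Graph_Theory.Digraph_Component" "HOL-Library.Disjoint_Sets"
begin

text \<open>
  A finite simple graph is a value satisfying the locale predicate \<^const>\<open>graph\<close>: a finite
  loop-free digraph without parallel arcs whose adjacency relation is symmetric. Each undirected
  edge is a pair of opposite arcs, so the degree of a vertex is its \<^const>\<open>out_degree\<close>.
\<close>

definition nbhd :: "('a, 'b) pre_digraph \<Rightarrow> 'a \<Rightarrow> 'a set" where
  "nbhd G v = {u. v \<rightarrow>\<^bsub>G\<^esub> u}"

text \<open>Meaningful only for graphs with at least one vertex.\<close>

definition min_degree :: "('a, 'b) pre_digraph \<Rightarrow> nat" where
  "min_degree G = Min (out_degree G ` verts G)"

definition full_vertex :: "('a, 'b) pre_digraph \<Rightarrow> 'a \<Rightarrow> bool" where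
  "full_vertex G v \<longleftrightarrow> v \<in> verts G \<and> out_degree G v = card (verts G) - 1"

definition isolate_free :: "('a, 'b) pre_digraph \<Rightarrow> bool" where
  "isolate_free G \<longleftrightarrow> (\<forall>v\<in>verts G. out_degree G v \<noteq> 0)"

definition dominating_set :: "('a, 'b) pre_digraph \<Rightarrow> 'a set \<Rightarrow> bool" where
  "dominating_set G S \<longleftrightarrow> S \<subseteq> verts G \<and> (\<forall>v\<in>verts G - S. \<exists>u\<in>S. v \<rightarrow>\<^bsub>G\<^esub> u)"

definition coalition :: "('a, 'b) pre_digraph \<Rightarrow> 'a set \<Rightarrow> 'a set \<Rightarrow> bool" where
  "coalition G A B \<longleftrightarrow> A \<subseteq> verts G \<and> B \<subseteq> verts G \<and> A \<inter> B = {} \<and>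
     \<not> dominating_set G A \<and> \<not> dominating_set G B \<and> dominating_set G (A \<union> B)"

definition coalition_partition :: "('a, 'b) pre_digraph \<Rightarrow> 'a set set \<Rightarrow> bool" where
  "coalition_partition G \<Psi> \<longleftrightarrow> partition_on (verts G) \<Psi> \<and>
     (\<forall>A\<in>\<Psi>. (dominating_set G A \<and> card A = 1) \<or>
            (\<not> dominating_set G A \<and> (\<exists>B\<in>\<Psi>. coalition G A B)))"

definition coalition_number :: "('a, 'b) pre_digraph \<Rightarrow> nat" where
  "coalition_number G = Max {card \<Psi> |\<Psi>. coalition_partition G \<Psi>}"

text \<open>
  The only pairs of vertices whose adjacency is left open below are those inside \<open>Q\<close> (subject
  to the condition on the induced subgraph) and those between \<open>y\<close> and \<open>P\<close>; since the graph is
  simple, the listed neighbourhoods determine every other pair, so there are no further edges.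
\<close>

definition family_F1 :: "('a, 'b) pre_digraph set" where
  "family_F1 = {G. graph G \<and> isolate_free G \<and>
     (\<exists>x y w P Q.
        x \<noteq> y \<and> x \<noteq> w \<and> y \<noteq> w \<and>
        {x, y, w} \<inter> P = {} \<and> {x, y, w} \<inter> Q = {} \<and> P \<inter> Q = {} \<and>
        verts G = {x, y, w} \<union> P \<union> Q \<and>
        card (P \<union> Q) \<ge> 1 \<and> (Q \<noteq> {} \<longrightarrow> card Q \<ge> 2) \<and>
        nbhd G x = {y} \<and> nbhd G w = P \<union> Q \<and>
        (\<forall>p\<in>P. (P \<union> Q) - {p} \<subseteq> nbhd G p) \<and>
        (Q \<noteq> {} \<longrightarrow> Q \<subseteq> nbhd G y \<and> (\<forall>q\<in>Q. \<not> full_vertex (G \<restriction> Q) q)))}"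

end

theory Submission
  imports Defs
begin

text \<open>
  A partition of \<open>V\<close> into \<open>n\<close> parts is the partition into singletons, and without full vertices no
  singleton is dominating, so \<open>\<C>(G) = n\<close> means that
  every vertex \<open>v\<close> has a partner \<open>u\<close> such that \<open>{v, u}\<close> dominates \<open>G\<close>. Let \<open>x\<close> be a leaf with
  neighbour \<open>y\<close>. Every dominating set contains \<open>x\<close> or \<open>y\<close>, so a vertex outside \<open>{x, y}\<close> has \<open>x\<close> or
  \<open>y\<close> as its partner. Let \<open>w\<close> be any non-neighbour of \<open>y\<close>; neither \<open>x\<close> nor \<open>y\<close> dominates \<open>w\<close>, hence
  every other vertex is adjacent to \<open>w\<close>. Among these, \<open>P\<close> consists of the vertices adjacent to all
  the others, and \<open>Q\<close> of the rest. A vertex of \<open>Q\<close> can only have \<open>y\<close> as its partner, and since it is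
  missed by some other vertex of \<open>Q\<close>, it must be adjacent to \<open>y\<close>.
\<close>

section \<open>Neighbourhoods and full vertices\<close>

lemma mem_nbhd_iff: "u \<in> nbhd G v \<longleftrightarrow> v \<rightarrow>\<^bsub>G\<^esub> u"
  by (simp add: nbhd_def)

text \<open>Without parallel arcs, \<open>head\<close> maps the arcs leaving \<open>v\<close>
  bijectively onto its neighbours.\<close>

lemma (in nomulti_digraph) out_degree_eq_card_nbhd: "out_degree G v = card (nbhd G v)"
proof -
  have "inj_on (head G) (out_arcs G v)"
    by (rule inj_onI) (auto intro: no_multi_arcs simp: arc_to_ends_def)
  moreover have "head G ` out_arcs G v = nbhd G v"
    by (force simp: nbhd_def arcs_ends_conv)
  ultimately show ?thesis
    by (metis card_image out_degree_def)
qed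

text \<open>There are no loops, so the neighbourhood lies in \<open>verts G - {v}\<close> and equals
  it once the cardinalities agree. The locale \<open>digraph\<close> makes this available for the
  induced subgraph on \<open>Q\<close> as well.\<close>

lemma (in digraph) full_vertex_iff:
  assumes "v \<in> verts G"
  shows "full_vertex G v \<longleftrightarrow> (\<forall>u\<in>verts G - {v}. v \<rightarrow>\<^bsub>G\<^esub> u)"
proof -
  have sub: "nbhd G v \<subseteq> verts G - {v}"
    using adj_in_verts adj_not_same by (auto simp: nbhd_def)
  have "full_vertex G v \<longleftrightarrow> card (nbhd G v) = card (verts G - {v})"
    using assms by (simp add: full_vertex_def out_degree_eq_card_nbhd)
  also have "\<dots> \<longleftrightarrow> nbhd G v = verts G - {v}"
    using sub by (metis card_subset_eq finite_Diff finite_verts)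
  also have "\<dots> \<longleftrightarrow> (\<forall>u\<in>verts G - {v}. v \<rightarrow>\<^bsub>G\<^esub> u)"
    using sub by (auto simp: nbhd_def)
  finally show ?thesis .
qed

section \<open>Partitions of extremal cardinality\<close>

lemma finite_partition_on_part:
  assumes "finite A" "partition_on A P" "p \<in> P"
  shows "finite p"
  using assms by (metis Union_upper finite_subset partition_onD1)

lemma partition_on_card_part_pos:
  assumes "finite A" "partition_on A P" "p \<in> P"
  shows "1 \<le> card p"
  using finite_partition_on_part[OF assms] assms(2,3)
  by (auto simp: Suc_le_eq card_gt_0_iff partition_on_def)

lemma partition_on_card_le:
  assumes "finite A" "partition_on A P"
  shows "card P \<le> card A"
proof -
  have "card P = (\<Sum>p\<in>P. 1)"
    by simp
  also have "\<dots> \<le> (\<Sum>p\<in>P. card p)"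
    by (intro sum_mono partition_on_card_part_pos[OF assms])
  also have "\<dots> = card A"
    using product_partition[OF assms(2) finite_partition_on_part[OF assms(1,2)]] by simp
  finally show ?thesis .
qed

text \<open>The part sizes are at least 1 and sum to \<open>card A\<close>. If there are
  \<open>card A\<close> parts, no size can exceed 1.\<close>

lemma partition_on_card_eq_imp_singletons:
  assumes "finite A" "partition_on A P" "card P = card A"
  shows "P = (\<lambda>a. {a}) ` A"
proof -
  have "card A = (\<Sum>p\<in>P. card p)"
    using product_partition[OF assms(2) finite_partition_on_part[OF assms(1,2)]] by simp
  then have "(\<Sum>p\<in>P. 1) = (\<Sum>p\<in>P. card p)"
    using assms(3) by simp
  then have one: "card p = 1" if "p \<in> P" for p
    using sum_mono_inv[of "\<lambda>_. 1" P card p] that finite_elements[OF assms(1,2)]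
      partition_on_card_part_pos[OF assms(1,2)] by simp
  have "p \<in> (\<lambda>a. {a}) ` A" if "p \<in> P" for p
  proof -
    obtain a where "p = {a}"
      using one[OF \<open>p \<in> P\<close>] by (auto simp: card_1_singleton_iff)
    moreover have "a \<in> A"
      unfolding partition_onD1[OF assms(2)] using that \<open>p = {a}\<close> by blast
    ultimately show ?thesis
      by blast
  qed
  moreover have "{a} \<in> P" if "a \<in> A" for a
  proof -
    obtain p where "p \<in> P" "a \<in> p"
      using \<open>a \<in> A\<close> unfolding partition_onD1[OF assms(2)] by blast
    then show ?thesis
      using one by (metis card_1_singletonE singletonD)
  qed
  ultimately show ?thesis
    by blast
qed

text \<open>
  The existence of some coalition partition cannot be dropped: \<^const>\<open>Max\<close> of the empty set is an
  unspecified number.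
\<close>

lemma (in fin_digraph) coalition_number_eq_order_iff:
  assumes "coalition_partition G \<Psi>"
  shows "coalition_number G = card (verts G) \<longleftrightarrow>
    coalition_partition G ((\<lambda>v. {v}) ` verts G)"
proof -
  let ?C = "{card \<Psi> |\<Psi>. coalition_partition G \<Psi>}"
  have le: "c \<le> card (verts G)" if "c \<in> ?C" for c
    using that partition_on_card_le[OF finite_verts] by (auto simp: coalition_partition_def)
  then have fin: "finite ?C"
    by (meson finite_nat_set_iff_bounded_le)
  have ne: "?C \<noteq> {}"
    using assms by blast
  have "coalition_number G = card (verts G) \<longleftrightarrow> card (verts G) \<in> ?C"
    unfolding coalition_number_def using Max_eq_iff[OF fin ne] le by blast
  also have "\<dots> \<longleftrightarrow> coalition_partition G ((\<lambda>v. {v}) ` verts G)"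
  proof
    assume "card (verts G) \<in> ?C"
    then obtain \<Phi> where "coalition_partition G \<Phi>" "card \<Phi> = card (verts G)"
      by auto
    then show "coalition_partition G ((\<lambda>v. {v}) ` verts G)"
      using partition_on_card_eq_imp_singletons[OF finite_verts]
      by (metis coalition_partition_def)
  next
    assume "coalition_partition G ((\<lambda>v. {v}) ` verts G)"
    moreover have "card ((\<lambda>v. {v}) ` verts G) = card (verts G)"
      by (simp add: card_image)
    ultimately show "card (verts G) \<in> ?C"
      by (metis (mono_tags, lifting) mem_Collect_eq)
  qed
  finally show ?thesis .
qed

section \<open>Graphs with a leaf and no full vertex\<close>

locale leafy_graph = graph +
  fixes x y :: 'a
  assumes nbhd_leaf: "nbhd G x = {y}"
    and no_full: "\<not> full_vertex G v"
begin

lemma adj_sym: "u \<rightarrow>\<^bsub>G\<^esub> v \<longleftrightarrow> v \<rightarrow>\<^bsub>G\<^esub> u"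
  using arcs_ends_symmetric[OF sym_arcs] by blast

lemma leaf_adj_iff: "x \<rightarrow>\<^bsub>G\<^esub> u \<longleftrightarrow> u = y" "u \<rightarrow>\<^bsub>G\<^esub> x \<longleftrightarrow> u = y"
  using nbhd_leaf adj_sym[of u x] by (simp_all add: nbhd_def set_eq_iff)

lemma leaf_verts: "x \<in> verts G" "y \<in> verts G" "x \<noteq> y"
  using adj_in_verts[of x y] adj_not_same[of x] leaf_adj_iff by auto

lemma ex_nonadjacent:
  assumes "v \<in> verts G"
  obtains u where "u \<in> verts G" "u \<noteq> v" "\<not> v \<rightarrow>\<^bsub>G\<^esub> u"
  using no_full full_vertex_iff[OF assms] by blast

lemma not_dominating_singleton: "\<not> dominating_set G {v}"
proof
  assume *: "dominating_set G {v}"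
  then have "v \<in> verts G"
    by (simp add: dominating_set_def)
  then obtain u where "u \<in> verts G" "u \<noteq> v" "\<not> v \<rightarrow>\<^bsub>G\<^esub> u"
    by (rule ex_nonadjacent)
  then show False
    using * adj_sym[of v u] by (auto simp: dominating_set_def)
qed

text \<open>Take \<open>{x, y}\<close> and its complement: the first misses a non-neighbour of
  \<open>y\<close>, the second misses the leaf \<open>x\<close>. This is what makes the maximum in
  \<open>coalition_number\<close> meaningful.\<close>

lemma ex_coalition_partition: "\<exists>\<Psi>. coalition_partition G \<Psi>"
proof -
  let ?A = "{x, y}"
  obtain z where z: "z \<in> verts G" "z \<noteq> y" "\<not> y \<rightarrow>\<^bsub>G\<^esub> z"
    using leaf_verts(2) by (rule ex_nonadjacent)
  then have zx: "z \<noteq> x"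
    using leaf_adj_iff by auto
  have "\<not> dominating_set G ?A"
    using z zx leaf_adj_iff adj_sym by (auto simp: dominating_set_def)
  moreover have "\<not> dominating_set G (verts G - ?A)"
    using leaf_verts leaf_adj_iff by (auto simp: dominating_set_def)
  moreover have "?A \<union> (verts G - ?A) = verts G"
    using leaf_verts by blast
  moreover have "dominating_set G (verts G)"
    by (simp add: dominating_set_def)
  ultimately have "coalition G ?A (verts G - ?A)" "coalition G (verts G - ?A) ?A"
    using leaf_verts by (auto simp: coalition_def Un_commute)
  moreover have "partition_on (verts G) {?A, verts G - ?A}"
    using leaf_verts z zx by (auto intro!: partition_onI simp: disjnt_def)
  ultimately have "coalition_partition G {?A, verts G - ?A}"
    by (auto simp: coalition_partition_def coalition_def)
  then show ?thesis ..
qed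

text \<open>The right-hand side can allow \<open>u = v\<close>, since \<open>{v, v}\<close> is a
  singleton and hence never dominating.\<close>

lemma coalition_partition_singletons_iff:
  "coalition_partition G ((\<lambda>v. {v}) ` verts G) \<longleftrightarrow>
    (\<forall>v\<in>verts G. \<exists>u\<in>verts G. dominating_set G {v, u})"
proof -
  have "coalition G {v} {u} \<longleftrightarrow> dominating_set G {v, u}"
    if "v \<in> verts G" "u \<in> verts G" for u v
    using that not_dominating_singleton
    by (cases "u = v") (auto simp: coalition_def insert_commute)
  then show ?thesis
    by (simp add: coalition_partition_def partition_on_singletons not_dominating_singleton)
qed

lemma family_F1_if_partners:
  assumes partners: "\<forall>v\<in>verts G. \<exists>u\<in>verts G. dominating_set G {v, u}"
    and "isolate_free G"
  shows "G \<in> family_F1"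
proof -
  have partner: "dominating_set G {v, x} \<or> dominating_set G {v, y}"
    if v: "v \<in> verts G" "v \<noteq> x" "v \<noteq> y" for v
  proof -
    obtain u where u: "dominating_set G {v, u}"
      using partners v by blast
    then have "u = x \<or> u = y"
      using v leaf_verts leaf_adj_iff by (auto simp: dominating_set_def)
    then show ?thesis
      using u by blast
  qed
  obtain w where w: "w \<in> verts G" "w \<noteq> y" "\<not> y \<rightarrow>\<^bsub>G\<^esub> w"
    using leaf_verts(2) by (rule ex_nonadjacent)
  have wx: "w \<noteq> x"
    using w leaf_adj_iff by auto
  define R where "R = verts G - {x, y, w}"
  have w_adj: "v \<rightarrow>\<^bsub>G\<^esub> w" if "v \<in> R" for v
  proof -
    have v: "v \<in> verts G" "v \<noteq> x" "v \<noteq> y" "w \<noteq> v"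
      using that by (auto simp: R_def)
    \<comment> \<open>The set formed by \<open>v\<close> and its partner has to dominate
      \<open>w\<close>, which lies outside it.\<close>
    have "w \<rightarrow>\<^bsub>G\<^esub> v \<or> w \<rightarrow>\<^bsub>G\<^esub> x \<or> w \<rightarrow>\<^bsub>G\<^esub> y"
      using partner[OF v(1-3)] w v(4) wx unfolding dominating_set_def by blast
    then show ?thesis
      using w leaf_adj_iff adj_sym[of w] by blast
  qed
  have nbhd_w: "nbhd G w = R"
  proof (intro subset_antisym subsetI)
    fix u assume "u \<in> nbhd G w"
    then have "w \<rightarrow>\<^bsub>G\<^esub> u"
      by (simp add: mem_nbhd_iff)
    then show "u \<in> R"
      using w wx leaf_adj_iff adj_sym adj_in_verts(2) adj_not_same by (auto simp: R_def)
  next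
    fix u assume "u \<in> R"
    then show "u \<in> nbhd G w"
      using w_adj[of u] adj_sym[of u w] by (simp add: mem_nbhd_iff)
  qed
  define P where "P = {p \<in> R. R - {p} \<subseteq> nbhd G p}"
  define Q where "Q = R - P"
  have PQ: "P \<union> Q = R" "P \<inter> Q = {}"
    by (auto simp: P_def Q_def)
  have Q_nonadj: "\<exists>r\<in>Q. r \<noteq> q \<and> \<not> q \<rightarrow>\<^bsub>G\<^esub> r" if "q \<in> Q" for q
  proof -
    obtain r where r: "r \<in> R" "r \<noteq> q" "\<not> q \<rightarrow>\<^bsub>G\<^esub> r"
      using \<open>q \<in> Q\<close> by (auto simp: Q_def P_def nbhd_def)
    \<comment> \<open>If \<open>r\<close> were in \<open>P\<close>, it would be adjacent to
      \<open>q\<close>.\<close>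
    moreover have "r \<in> Q"
      using r \<open>q \<in> Q\<close> adj_sym[of q r] by (auto simp: Q_def P_def nbhd_def)
    ultimately show ?thesis
      by blast
  qed
  have y_Q: "y \<rightarrow>\<^bsub>G\<^esub> q" if "q \<in> Q" for q
  proof -
    obtain r where "r \<in> Q" "r \<noteq> q" "\<not> q \<rightarrow>\<^bsub>G\<^esub> r"
      using Q_nonadj \<open>q \<in> Q\<close> by blast
    \<comment> \<open>The partner of \<open>r\<close> decides, not that of \<open>q\<close>: the
      pair dominates \<open>q\<close>, but neither \<open>r\<close> nor the leaf \<open>x\<close> is
      adjacent to \<open>q\<close>, so \<open>y\<close> is.\<close>
    then show ?thesis
      using partner[of r] that leaf_adj_iff adj_sym[of q r] adj_sym[of q y]
      by (auto simp: Q_def R_def dominating_set_def)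
  qed
  have not_full_Q: "\<not> full_vertex (G \<restriction> Q) q" if "q \<in> Q" for q
  proof -
    have "induced_subgraph (G \<restriction> Q) G"
      by (rule induced_induce) (auto simp: Q_def R_def)
    then have "digraph (G \<restriction> Q)"
      by (rule digraphI_induced)
    then show ?thesis
      using Q_nonadj[OF that] that
      by (auto simp: digraph.full_vertex_iff dest: dominates_induce_subgraphD)
  qed
  have finR: "finite R"
    by (simp add: R_def)
  \<comment> \<open>The neighbourhood of \<open>w\<close> is \<open>P \<union> Q\<close>, and
    \<open>w\<close> is not isolated.\<close>
  have "card (P \<union> Q) \<ge> 1"
    unfolding PQ(1) using \<open>isolate_free G\<close> w(1) nbhd_w
    by (auto simp: isolate_free_def out_degree_eq_card_nbhd Suc_le_eq)
  moreover have "Q \<noteq> {} \<longrightarrow> card Q \<ge> 2"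
  proof
    assume "Q \<noteq> {}"
    obtain q r where "q \<in> Q" "r \<in> Q" "r \<noteq> q"
      using Q_nonadj \<open>Q \<noteq> {}\<close> by blast
    then show "card Q \<ge> 2"
      using card_mono[of Q "{q, r}"] finR by (simp add: Q_def)
  qed
  moreover have "{x, y, w} \<inter> P = {}" "{x, y, w} \<inter> Q = {}"
    by (auto simp: P_def Q_def R_def)
  moreover have "verts G = {x, y, w} \<union> P \<union> Q"
    using leaf_verts w PQ by (auto simp: R_def)
  moreover have "\<forall>p\<in>P. (P \<union> Q) - {p} \<subseteq> nbhd G p"
    unfolding PQ(1) by (simp add: P_def)
  moreover have "Q \<noteq> {} \<longrightarrow>
      Q \<subseteq> nbhd G y \<and> (\<forall>q\<in>Q. \<not> full_vertex (G \<restriction> Q) q)"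
    using y_Q not_full_Q by (auto simp: nbhd_def)
  moreover have "graph G"
    by unfold_locales
  moreover have "x \<noteq> w" "y \<noteq> w"
    using wx w by auto
  moreover have "nbhd G w = P \<union> Q"
    using nbhd_w PQ(1) by simp
  ultimately show ?thesis
    unfolding family_F1_def mem_Collect_eq
    using PQ(2) leaf_verts(3) nbhd_leaf \<open>isolate_free G\<close>
    by - (rule conjI, assumption, rule conjI, assumption,
      rule exI[of _ x], rule exI[of _ y], rule exI[of _ w], rule exI[of _ P], rule exI[of _ Q],
      (intro conjI; assumption))
qed

end

text \<open>The partner is \<open>w\<close> for \<open>x\<close> and \<open>y\<close>,
  \<open>x\<close> for \<open>w\<close> and each vertex of \<open>P\<close>, and \<open>y\<close>
  for each vertex of \<open>Q\<close>.\<close>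

lemma partners_if_family_F1:
  assumes "G \<in> family_F1" "v \<in> verts G"
  shows "\<exists>u\<in>verts G. dominating_set G {v, u}"
proof -
  interpret graph G
    using assms by (simp add: family_F1_def)
  have sym: "a \<rightarrow>\<^bsub>G\<^esub> b \<longleftrightarrow> b \<rightarrow>\<^bsub>G\<^esub> a" for a b
    using arcs_ends_symmetric[OF sym_arcs] by blast
  obtain x y w P Q where V: "verts G = {x, y, w} \<union> P \<union> Q"
    and x: "nbhd G x = {y}" and w: "nbhd G w = P \<union> Q"
    and P: "\<forall>p\<in>P. (P \<union> Q) - {p} \<subseteq> nbhd G p"
    and Q: "Q \<noteq> {} \<longrightarrow> Q \<subseteq> nbhd G y"
    using assms(1) unfolding family_F1_def mem_Collect_eq by (elim conjE exE) (rule that, assumption+, blast)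
  have yx: "y \<rightarrow>\<^bsub>G\<^esub> x"
    using x sym mem_nbhd_iff by (metis singletonI)
  have rw: "r \<rightarrow>\<^bsub>G\<^esub> w" if "r \<in> P \<union> Q" for r
    using w that sym mem_nbhd_iff by metis
  have rp: "r \<rightarrow>\<^bsub>G\<^esub> p" if "p \<in> P" "r \<in> P \<union> Q" "r \<noteq> p" for r p
    using P that sym[of r p] mem_nbhd_iff[of r G p] by blast
  have qy: "q \<rightarrow>\<^bsub>G\<^esub> y" if "q \<in> Q" for q
    using Q that sym[of q y] mem_nbhd_iff[of q G y] by blast
  consider "v \<in> {x, y}" | "v = w" | "v \<in> P" | "v \<in> Q"
    using assms(2) V by blast
  then show ?thesis
  proof cases
    case 1
    then have "dominating_set G {v, w}"
      using V yx rw sym[of x y] by (auto simp: dominating_set_def)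
    then show ?thesis
      using V by blast
  next
    case 2
    then have "dominating_set G {v, x}"
      using V yx rw by (auto simp: dominating_set_def)
    then show ?thesis
      using V by blast
  next
    case 3
    then have "dominating_set G {v, x}"
      using V yx rw[of v] rp[of v] sym[of w v] by (auto simp: dominating_set_def)
    then show ?thesis
      using V by blast
  next
    case 4
    \<comment> \<open>Here \<open>v\<close> dominates \<open>w\<close> and \<open>P\<close>, while
      \<open>y\<close> dominates \<open>x\<close> and \<open>Q\<close>.\<close>
    then have "dominating_set G {v, y}"
      using V sym[of x y] yx sym[of w v] rw[of v] sym[of _ v] rp[of _ v] qy by (auto simp: dominating_set_def)
    then show ?thesis
      using V by blast
  qed
qed

theorem theorem5:
  fixes G :: "('a, 'b) pre_digraph"
  assumes "graph G"
    and "verts G \<noteq> {}"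
    and "min_degree G = 1"
    and "\<not> (\<exists>v. full_vertex G v)"
  shows "coalition_number G = card (verts G) \<longleftrightarrow> G \<in> family_F1"
proof -
  interpret graph G
    by (rule assms)
  \<comment> \<open>The minimum over a finite nonempty vertex set is attained, which yields the
    leaf.\<close>
  have "1 \<in> out_degree G ` verts G"
    using assms(2) Min_in[of "out_degree G ` verts G"] assms(3)[unfolded min_degree_def] by simp
  then obtain x where "out_degree G x = 1"
    by (metis imageE)
  then obtain y where y: "nbhd G x = {y}"
    by (metis card_1_singletonE out_degree_eq_card_nbhd)
  interpret leafy_graph G x y
    using y assms(4) by unfold_locales auto
  have "out_degree G v \<ge> 1" if "v \<in> verts G" for v
    using Min_le[of "out_degree G ` verts G" "out_degree G v"] that assms(3)[unfolded min_degree_def]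
    by simp
  then have "isolate_free G"
    by (force simp: isolate_free_def)
  then show ?thesis
    using ex_coalition_partition coalition_number_eq_order_iff coalition_partition_singletons_iff
      family_F1_if_partners partners_if_family_F1 by metis
qed

end
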